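(* Let $\eta$ be a continuous partial action of a profinite group $G$ on a profinite space $X$. If $G*X$ is closed in $G\times X$, then the enveloping space $X_G$ is profinite.
   Context: A topological space is profinite if it is homeomorphic to an inverse limit of finite discrete spaces; equivalently, it is compact, Hausdorff and zero-dimensional. A topological group is profinite if it is profinite as a topological space. A partial action $\eta$ of a group $G$ (with identity $1$) on a set $X$ is a partially defined map $G\times X\to X$, $(g,x)\mapsto g\cdot x$ (write $\exists g\cdot x$ when $g\cdot x$ is defined), such that for all $g,h\in G$, $x\in X$: (PA1) if $\exists g\cdot x$, then $\exists g^{-1}\cdot(g\cdot x)$ and $g^{-1}\cdot(g\cdot x)=x$; (PA2) if $\exists g\cdot(h\cdot x)$, then $\exists (gh)\cdot x$ and $g\cdot(h\cdot x)=(gh)\cdot x$; (PA3) $\exists 1\cdot x$ and $1\cdot x=x$. Put $G*X=\{(g,x)\in G\times X: \exists g\cdot x\}$ (the domain of $\eta$), $X_g=\{x\in X:\exists g^{-1}\cdot x\}$, and $\eta_g:X_{g^{-1}}\to X_g$, $x\mapsto g\cdot x$ (a bijection). When $G$ is a topological group and $X$ a topological space, $G\times X$ has the product topology and $G*X$ the subspace topology; $\eta$ is topological if every $X_g$ is open in $X$ and every $\eta_g$ is a homeomorphism; $\eta$ is a continuous partial action if it is topological and $\eta:G*X\to X$ is continuous. The enveloping space (globalization) of $X$ is $X_G=(G\times X)/R$ with the quotient topology, where $R$ is the equivalence relation $(g,x)R(h,y)\iff x\in X_{g^{-1}h}$ and $\eta_{h^{-1}g}(x)=y$. *)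

theory Defs
  imports "HOL-Analysis.Analysis" "HOL-Algebra.Group"
begin

section \<open>Profinite spaces\<close>

definition inverse_system ::
  "'i set \<Rightarrow> 'i rel \<Rightarrow> ('i \<Rightarrow> 'b topology) \<Rightarrow> ('i \<Rightarrow> 'i \<Rightarrow> 'b \<Rightarrow> 'b) \<Rightarrow> bool" where
  "inverse_system I r Y f \<longleftrightarrow>
     I \<noteq> {} \<and> partial_order_on I r \<and>
     (\<forall>i\<in>I. \<forall>j\<in>I. \<exists>k\<in>I. (i, k) \<in> r \<and> (j, k) \<in> r) \<and>
     (\<forall>i j. (i, j) \<in> r \<longrightarrow> continuous_map (Y j) (Y i) (f i j)) \<and>
     (\<forall>i\<in>I. \<forall>y\<in>topspace (Y i). f i i y = y) \<and>
     (\<forall>i j k. (i, j) \<in> r \<longrightarrow> (j, k) \<in> r \<longrightarrow>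
        (\<forall>y\<in>topspace (Y k). f i j (f j k y) = f i k y))"

definition inverse_limit ::
  "'i set \<Rightarrow> 'i rel \<Rightarrow> ('i \<Rightarrow> 'b topology) \<Rightarrow> ('i \<Rightarrow> 'i \<Rightarrow> 'b \<Rightarrow> 'b) \<Rightarrow> ('i \<Rightarrow> 'b) topology" where
  "inverse_limit I r Y f =
     subtopology (product_topology Y I) {x. \<forall>i j. (i, j) \<in> r \<longrightarrow> f i j (x j) = x i}"

text \<open>A formula cannot quantify over types, so the index type and the type of the points of the
  finite spaces are fixed here in terms of the point type of the space. This is no restriction:
  by \<open>profinite_space_inverse_limit\<close> below, an inverse limit of finite discrete spaces over
  arbitrary types is profinite in this sense.\<close>

definition profinite_space :: "'a topology \<Rightarrow> bool" where
  "profinite_space X \<longleftrightarrow>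
     (\<exists>(I :: 'a set set set) r (D :: 'a set set \<Rightarrow> 'a set set) f.
        inverse_system I r (\<lambda>i. discrete_topology (D i)) f \<and> (\<forall>i\<in>I. finite (D i)) \<and>
        X homeomorphic_space inverse_limit I r (\<lambda>i. discrete_topology (D i)) f)"

lemma inverse_limit_finite_discrete:
  assumes sys: "inverse_system I r (\<lambda>i. discrete_topology (D i)) f"
    and fin: "\<forall>i\<in>I. finite (D i)"
  defines "L \<equiv> inverse_limit I r (\<lambda>i. discrete_topology (D i)) f"
  shows "compact_space L" "Hausdorff_space L" "L dim_le 0"
proof -
  define P where "P = product_topology (\<lambda>i. discrete_topology (D i)) I"
  define S where "S = {x. \<forall>i j. (i, j) \<in> r \<longrightarrow> f i j (x j) = x i}"
  have L: "L = subtopology P S"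
    by (simp add: L_def P_def S_def inverse_limit_def)
  have rI: "i \<in> I \<and> j \<in> I" if "(i, j) \<in> r" for i j
    using sys that by (auto simp: inverse_system_def partial_order_on_def preorder_on_def)
  have Hd: "Hausdorff_space P"
    by (simp add: P_def Hausdorff_space_product_topology)
  have cp: "compact_space P"
    using fin by (simp add: P_def compact_space_product_topology compact_space_discrete_topology)
  show "Hausdorff_space L"
    using Hd by (simp add: L Hausdorff_space_subtopology)
  have cl: "closedin P {x \<in> topspace P. f i j (x j) = x i}" if ij: "(i, j) \<in> r" for i j
  proof (rule closedin_continuous_maps_eq)
    show "Hausdorff_space (discrete_topology (D i))" by simp
    show "continuous_map P (discrete_topology (D i)) (\<lambda>x. x i)"
      unfolding P_def
      using continuous_map_product_projection[of i I "\<lambda>i. discrete_topology (D i)"] rI[OF ij] by simp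
    have 1: "continuous_map P (discrete_topology (D j)) (\<lambda>x. x j)"
      unfolding P_def
      using continuous_map_product_projection[of j I "\<lambda>i. discrete_topology (D i)"] rI[OF ij] by simp
    have 2: "continuous_map (discrete_topology (D j)) (discrete_topology (D i)) (f i j)"
      using sys ij unfolding inverse_system_def by blast
    show "continuous_map P (discrete_topology (D i)) (\<lambda>x. f i j (x j))"
      using continuous_map_compose[OF 1 2] by (simp add: o_def)
  qed
  have "closedin P (topspace P \<inter> (\<Inter>(i,j)\<in>r. {x \<in> topspace P. f i j (x j) = x i}))"
  proof (cases "r = {}")
    case False
    then show ?thesis
      by (intro closedin_Int closedin_topspace closedin_INT) (auto intro: cl)
  qed simp
  moreover have "topspace P \<inter> (\<Inter>(i,j)\<in>r. {x \<in> topspace P. f i j (x j) = x i}) = topspace P \<inter> S"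
    by (auto simp: S_def)
  ultimately have "compactin P (topspace P \<inter> S)"
    using closedin_compact_space[OF cp] by simp
  then have "compact_space (subtopology P (topspace P \<inter> S))"
    by (rule compact_space_subtopology)
  then show "compact_space L"
    by (metis L subtopology_restrict)
  show "L dim_le 0"
    unfolding dimension_le_0_neighbourhood_base_of_clopen
  proof (subst open_neighbourhood_base_of, blast, intro allI impI, elim conjE)
    fix W x assume W: "openin L W" "x \<in> W"
    then obtain V where V: "openin P V" "W = V \<inter> S"
      by (auto simp: L openin_subtopology)
    then have "x \<in> V" using W by simp
    with V(1) obtain U where U: "finite {i \<in> I. U i \<noteq> D i}" "\<forall>i\<in>I. U i \<subseteq> D i"
        "x \<in> Pi\<^sub>E I U" "Pi\<^sub>E I U \<subseteq> V"
      unfolding P_def openin_product_topology_alt by (auto; blast)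
    have "openin P (Pi\<^sub>E I U)"
      unfolding P_def using U by (subst openin_PiE_gen) auto
    moreover have "closedin P (Pi\<^sub>E I U)"
      unfolding P_def using U by (subst closedin_product_topology) auto
    ultimately have "openin L (S \<inter> Pi\<^sub>E I U)" "closedin L (S \<inter> Pi\<^sub>E I U)"
      unfolding L by (auto simp: openin_subtopology_Int2 closedin_subtopology)
    then show "\<exists>U. (closedin L U \<and> openin L U) \<and> x \<in> U \<and> U \<subseteq> W"
      using U W V by (intro exI[of _ "S \<inter> Pi\<^sub>E I U"]) auto
  qed
qed

lemma compact_Hausdorff_dim_0_imp_profinite_space:
  fixes X :: "'a topology"
  assumes cpt: "compact_space X" and Hd: "Hausdorff_space X" and zd: "X dim_le 0"
  shows "profinite_space X"
proof -
  define C where "C = {P. finite P \<and> \<Union>P = topspace X \<and> disjoint P \<and> {} \<notin> P \<and> (\<forall>A\<in>P. openin X A)}"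
  define r where "r = {(P, Q). P \<in> C \<and> Q \<in> C \<and> (\<forall>B\<in>Q. \<exists>A\<in>P. B \<subseteq> A)}"
  define cell where "cell P x = (THE A. A \<in> P \<and> x \<in> A)" for P :: "'a set set" and x
  define f where "f P (Q :: 'a set set) B = cell P (SOME x. x \<in> B)" for P Q B
  define Y where "Y P = discrete_topology P" for P :: "'a set set"
  have cell_eq: "cell P x = A" if "P \<in> C" "A \<in> P" "x \<in> A" for P A x
    using that unfolding cell_def C_def disjoint_def by (intro the_equality) auto
  have cell: "cell P x \<in> P \<and> x \<in> cell P x" if P: "P \<in> C" and x: "x \<in> topspace X" for P x
  proof -
    have "x \<in> \<Union>P" using P x by (simp add: C_def)
    then obtain A where "A \<in> P" "x \<in> A" by blast
    then show ?thesis using cell_eq[OF P] by metis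
  qed
  have nonempty: "\<exists>x. x \<in> B" if "P \<in> C" "B \<in> P" for P B
  proof -
    have "B \<noteq> {}" using that by (auto simp: C_def)
    then show ?thesis by blast
  qed
  have inX: "x \<in> topspace X" if "P \<in> C" "B \<in> P" "x \<in> B" for P B x
    using that by (auto simp: C_def)
  have f_eq: "f P Q B = cell P x" if PQ: "(P, Q) \<in> r" and B: "B \<in> Q" "x \<in> B" for P Q B x
  proof -
    obtain A where A: "A \<in> P" "B \<subseteq> A" using PQ B by (auto simp: r_def)
    have "P \<in> C" using PQ by (simp add: r_def)
    moreover have "(SOME x. x \<in> B) \<in> B" using B by (meson someI)
    ultimately show ?thesis
      unfolding f_def using A B cell_eq by (metis subsetD)
  qed
  have f_cell: "f P Q (cell Q x) = cell P x" if "(P, Q) \<in> r" "x \<in> topspace X" for P Q x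
    using that cell[of Q x] by (intro f_eq) (auto simp: r_def)
  have is_cell: "\<exists>x\<in>topspace X. B = cell P x" if "P \<in> C" "B \<in> P" for P B
    using that nonempty inX cell_eq by metis
  have f_sub: "B \<subseteq> f P Q B" if PQ: "(P, Q) \<in> r" and B: "B \<in> Q" for P Q B
  proof
    fix x assume x: "x \<in> B"
    have QC: "Q \<in> C" "P \<in> C" using PQ by (auto simp: r_def)
    show "x \<in> f P Q B"
      using f_eq[OF PQ B x] cell[OF QC(2) inX[OF QC(1) B x]] by simp
  qed
  have directed: "\<exists>R\<in>C. (P, R) \<in> r \<and> (Q, R) \<in> r" if P: "P \<in> C" and Q: "Q \<in> C" for P Q
  proof -
    define R where "R = (\<lambda>(A, B). A \<inter> B) ` (P \<times> Q) - {{}}"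
    have "finite R" using P Q by (simp add: R_def C_def)
    moreover have "\<Union>R = \<Union>P \<inter> \<Union>Q" by (auto simp: R_def)
    moreover have "disjoint R"
    proof -
      have "\<forall>A\<in>P. \<forall>A'\<in>P. A \<noteq> A' \<longrightarrow> A \<inter> A' = {}" "\<forall>B\<in>Q. \<forall>B'\<in>Q. B \<noteq> B' \<longrightarrow> B \<inter> B' = {}"
        using P Q by (simp_all add: C_def disjoint_def)
      then show ?thesis unfolding R_def disjoint_def by (auto; blast)
    qed
    moreover have "\<forall>A\<in>R. openin X A" using P Q by (auto simp: R_def C_def)
    moreover have "{} \<notin> R" by (simp add: R_def)
    ultimately have "R \<in> C" using P Q by (simp add: C_def)
    moreover have "\<forall>B\<in>R. \<exists>A\<in>P. B \<subseteq> A" "\<forall>B\<in>R. \<exists>A\<in>Q. B \<subseteq> A" by (auto simp: R_def)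
    ultimately show ?thesis using P Q by (auto simp: r_def)
  qed
  have antis: "P \<subseteq> Q" if PQ: "(P, Q) \<in> r" and QP: "(Q, P) \<in> r" for P Q
  proof
    fix A assume A: "A \<in> P"
    have C: "P \<in> C" "Q \<in> C" using PQ by (auto simp: r_def)
    obtain B where B: "B \<in> Q" "A \<subseteq> B" using QP A by (auto simp: r_def)
    obtain A' where A': "A' \<in> P" "B \<subseteq> A'" using PQ B by (auto simp: r_def)
    obtain x where "x \<in> A" using nonempty C A by blast
    then have "A = A'" using cell_eq C A A' B by (metis subsetD)
    then show "A \<in> Q" using B A' by auto
  qed
  have po: "partial_order_on C r"
    unfolding partial_order_on_def preorder_on_def
  proof (intro conjI)
    show "r \<subseteq> C \<times> C" by (auto simp: r_def)
    show "refl_on C r" by (auto simp: r_def refl_on_def)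
    show "trans r" by (rule transI) (simp add: r_def, meson subset_trans)
    show "antisym r" using antis by (intro antisymI) blast
  qed
  have "{topspace X} - {{}} \<in> C"
    by (auto simp: C_def disjoint_def)
  then have Cne: "C \<noteq> {}" by blast
  have sys: "inverse_system C r (\<lambda>P. discrete_topology P) f"
    unfolding inverse_system_def
  proof (intro conjI allI ballI impI)
    show "C \<noteq> {}" "partial_order_on C r" by (fact Cne, fact po)
    show "\<exists>k\<in>C. (i, k) \<in> r \<and> (j, k) \<in> r" if "i \<in> C" "j \<in> C" for i j
      using directed that by blast
    show "continuous_map (discrete_topology j) (discrete_topology i) (f i j)" if "(i, j) \<in> r" for i j
    proof -
      have "f i j B \<in> i" if B: "B \<in> j" for B
      proof -
        have "i \<in> C" "j \<in> C" using \<open>(i, j) \<in> r\<close> by (auto simp: r_def)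
        then obtain x where "x \<in> topspace X" "B = cell j x" using is_cell B by blast
        then show ?thesis using f_cell \<open>(i, j) \<in> r\<close> cell \<open>i \<in> C\<close> by metis
      qed
      then show ?thesis by auto
    qed
    show "f i i y = y" if i: "i \<in> C" and y: "y \<in> topspace (discrete_topology i)" for i y
    proof -
      have "(i, i) \<in> r" using i by (auto simp: r_def)
      moreover obtain x where "x \<in> topspace X" "y = cell i x" using is_cell i y by auto
      ultimately show ?thesis using f_cell by metis
    qed
    show "f i j (f j k y) = f i k y"
      if ij: "(i, j) \<in> r" and jk: "(j, k) \<in> r" and y: "y \<in> topspace (discrete_topology k)" for i j k y
    proof -
      have "k \<in> C" using jk by (auto simp: r_def)
      then obtain x where x: "x \<in> topspace X" "y = cell k x" using is_cell y by auto
      have "(i, k) \<in> r" using po ij jk unfolding partial_order_on_def preorder_on_def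
        by (meson transD)
      then show ?thesis using f_cell ij jk x by metis
    qed
  qed
  define L where "L = inverse_limit C r (\<lambda>P. discrete_topology P) f"
  have topL: "topspace L = {z \<in> (\<Pi>\<^sub>E P\<in>C. P). \<forall>P Q. (P, Q) \<in> r \<longrightarrow> f P Q (z Q) = z P}"
    by (auto simp: L_def inverse_limit_def)
  define \<phi> where "\<phi> x = (\<lambda>P\<in>C. cell P x)" for x
  have rC: "P \<in> C \<and> Q \<in> C" if "(P, Q) \<in> r" for P Q using that by (auto simp: r_def)
  have cont1: "continuous_map X (discrete_topology P) (cell P)" if P: "P \<in> C" for P
  proof -
    have "openin X {x \<in> topspace X. cell P x \<in> U}" if U: "U \<subseteq> P" for U
    proof -
      have "{x \<in> topspace X. cell P x \<in> U} = \<Union>U"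
        using cell[OF P] cell_eq[OF P] inX[OF P] U by auto
      moreover have "openin X (\<Union>U)" using U P by (intro openin_Union) (auto simp: C_def)
      ultimately show ?thesis by simp
    qed
    then show ?thesis using cell[OF P] by (auto simp: continuous_map_def)
  qed
  have "homeomorphic_map X L \<phi>"
  proof (rule continuous_imp_homeomorphic_map)
    have into: "\<phi> \<in> topspace X \<rightarrow> topspace L"
      unfolding topL \<phi>_def using cell f_cell rC by auto
    have "continuous_map X (product_topology (\<lambda>P. discrete_topology P) C) \<phi>"
      unfolding \<phi>_def
    proof (rule continuous_map_coordinatewise_then_product)
      fix P assume P: "P \<in> C"
      then show "continuous_map X (discrete_topology P) (\<lambda>x. (\<lambda>P\<in>C. cell P x) P)"
        using cont1[OF P] by simp
    qed auto
    then show "continuous_map X L \<phi>"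
      using into unfolding L_def inverse_limit_def
      by (subst continuous_map_in_subtopology) (auto simp: image_subset_iff)
    show "compact_space X" by fact
    show "Hausdorff_space L"
      unfolding L_def using inverse_limit_finite_discrete[OF sys] by (simp add: C_def)
    show "inj_on \<phi> (topspace X)"
    proof (rule inj_onI, rule ccontr)
      fix x y assume xy: "x \<in> topspace X" "y \<in> topspace X" "\<phi> x = \<phi> y" "x \<noteq> y"
      then obtain V where "openin X V" "x \<in> V" "y \<notin> V"
        using Hd unfolding Hausdorff_space_def disjnt_def by (metis disjoint_iff)
      then obtain U where U: "closedin X U" "openin X U" "x \<in> U" "y \<notin> U"
        using zd unfolding dimension_le_0_neighbourhood_base_of_clopen
        by (subst (asm) open_neighbourhood_base_of) blast+
      define P where "P = {U, topspace X - U}"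
      have P: "P \<in> C"
        using U xy openin_subset[OF U(2)] unfolding C_def P_def disjoint_def by auto
      have "cell P x = U"
        using U by (intro cell_eq[OF P]) (auto simp: P_def)
      moreover have "cell P y = topspace X - U"
        using U xy by (intro cell_eq[OF P]) (auto simp: P_def)
      moreover have "cell P x = cell P y"
        using fun_cong[OF xy(3), of P] P by (simp add: \<phi>_def)
      ultimately show False using U by blast
    qed
    show "\<phi> ` topspace X = topspace L"
    proof
      show "\<phi> ` topspace X \<subseteq> topspace L" using into by auto
      show "topspace L \<subseteq> \<phi> ` topspace X"
      proof
        fix z assume z: "z \<in> topspace L"
        have zP: "z P \<in> P" if "P \<in> C" for P using z that by (auto simp: topL)
        have zsub: "z Q \<subseteq> z P" if "(P, Q) \<in> r" for P Q
          using f_sub[OF that zP] z that rC by (auto simp: topL)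
        have clo: "closedin X (z P)" if P: "P \<in> C" for P
        proof -
          have "z P = topspace X - \<Union>(P - {z P})"
            using zP[OF P] P unfolding C_def disjoint_def by auto
          moreover have "openin X (\<Union>(P - {z P}))"
            using P by (intro openin_Union) (auto simp: C_def)
          ultimately show ?thesis by (metis closedin_diff closedin_topspace)
        qed
        have bound: "\<exists>Q\<in>C. \<forall>P\<in>F. (P, Q) \<in> r" if "finite F" "F \<subseteq> C" for F
          using that
        proof (induction F rule: finite_induct)
          case empty
          then show ?case using Cne by auto
        next
          case (insert P F)
          then obtain Q where Q: "Q \<in> C" "\<forall>P\<in>F. (P, Q) \<in> r" by auto
          obtain R where "R \<in> C" "(P, R) \<in> r" "(Q, R) \<in> r"
            using directed[of P Q] Q(1) insert.prems by auto
          moreover have "trans r" using po by (simp add: partial_order_on_def preorder_on_def)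
          ultimately show ?case using Q by (intro bexI[of _ R]) (blast dest: transD)+
        qed
        have "\<Inter>(z ` C) \<noteq> {}"
        proof (rule cpt[unfolded compact_space_fip, rule_format], intro conjI ballI allI impI)
          show "closedin X K" if "K \<in> z ` C" for K using that clo by auto
          fix F assume "finite F \<and> F \<subseteq> z ` C"
          then obtain F' where F': "finite F'" "F' \<subseteq> C" "F = z ` F'"
            by (meson finite_subset_image)
          then obtain Q where Q: "Q \<in> C" "\<forall>P\<in>F'. (P, Q) \<in> r" using bound by blast
          then have "z Q \<subseteq> \<Inter>F" unfolding F'(3) by (intro INT_greatest zsub) blast
          then show "\<Inter>F \<noteq> {}" using nonempty[OF Q(1) zP[OF Q(1)]] by auto
        qed
        then obtain x where x: "\<forall>P\<in>C. x \<in> z P" by auto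
        then have "x \<in> topspace X" using Cne inX zP by blast
        moreover have "z = \<phi> x"
        proof
          fix P
          show "z P = \<phi> x P"
            using z x zP cell_eq[of P "z P" x] unfolding topL \<phi>_def PiE_def extensional_def by auto
        qed
        ultimately show "z \<in> \<phi> ` topspace X" by blast
      qed
    qed
  qed
  then have "X homeomorphic_space L"
    by (rule homeomorphic_map_imp_homeomorphic_space)
  then show ?thesis
    unfolding profinite_space_def using sys
    by (intro exI[of _ C] exI[of _ r] exI[of _ "\<lambda>P. P"] exI[of _ f]) (auto simp: L_def C_def)
qed

theorem profinite_space_inverse_limit:
  assumes "inverse_system I r (\<lambda>i. discrete_topology (D i)) f" "\<forall>i\<in>I. finite (D i)"
    and hom: "X homeomorphic_space inverse_limit I r (\<lambda>i. discrete_topology (D i)) f"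
  shows "profinite_space X"
  by (rule compact_Hausdorff_dim_0_imp_profinite_space)
    (simp_all add: inverse_limit_finite_discrete[OF assms(1,2)] homeomorphic_compact_space[OF hom]
      homeomorphic_Hausdorff_space[OF hom] homeomorphic_space_dimension_le[OF hom])

theorem profinite_space_iff:
  fixes X :: "'a topology"
  shows
  "profinite_space X \<longleftrightarrow> compact_space X \<and> Hausdorff_space X \<and> X dim_le 0"
proof
  assume "profinite_space X"
  then obtain I :: "'a set set set" and r and D :: "'a set set \<Rightarrow> 'a set set" and f
    where sys: "inverse_system I r (\<lambda>i. discrete_topology (D i)) f" "\<forall>i\<in>I. finite (D i)"
      and hom: "X homeomorphic_space inverse_limit I r (\<lambda>i. discrete_topology (D i)) f"
    unfolding profinite_space_def by blast
  then show "compact_space X \<and> Hausdorff_space X \<and> X dim_le 0"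
    by (simp add: inverse_limit_finite_discrete[OF sys] homeomorphic_compact_space[OF hom]
        homeomorphic_Hausdorff_space[OF hom] homeomorphic_space_dimension_le[OF hom])
qed (simp add: compact_Hausdorff_dim_0_imp_profinite_space)


section \<open>Topological groups and partial actions\<close>

locale topological_group = group G for G (structure) +
  fixes TG :: "'g topology"
  assumes topspace_eq_carrier: "topspace TG = carrier G"
    and continuous_mult: "continuous_map (prod_topology TG TG) TG (\<lambda>(g, h). g \<otimes> h)"
    and continuous_inv: "continuous_map TG TG (\<lambda>g. inv g)"

definition profinite_group :: "('g, 'm) monoid_scheme \<Rightarrow> 'g topology \<Rightarrow> bool" where
  "profinite_group G TG \<longleftrightarrow> topological_group G TG \<and> profinite_space TG"

text \<open>\<open>\<eta> g x = None\<close> means that \<open>g \<cdot> x\<close> is undefined. Values of \<open>\<eta>\<close> outside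
  \<open>carrier G \<times> X\<close> are irrelevant.\<close>

locale partial_action = group G for G (structure) +
  fixes X :: "'x set" and \<eta> :: "'g \<Rightarrow> 'x \<Rightarrow> 'x option"
  assumes action_closed:
      "\<lbrakk>g \<in> carrier G; x \<in> X; \<eta> g x = Some y\<rbrakk> \<Longrightarrow> y \<in> X"
    and PA1: "\<lbrakk>g \<in> carrier G; x \<in> X; \<eta> g x = Some y\<rbrakk> \<Longrightarrow> \<eta> (inv g) y = Some x"
    and PA2: "\<lbrakk>g \<in> carrier G; h \<in> carrier G; x \<in> X; \<eta> h x = Some y; \<eta> g y = Some z\<rbrakk>
                \<Longrightarrow> \<eta> (g \<otimes> h) x = Some z"
    and PA3: "x \<in> X \<Longrightarrow> \<eta> \<one> x = Some x"

text \<open>The sets \<open>G * X\<close> and \<open>X\<^sub>g\<close>, and the maps \<open>\<eta>\<^sub>g\<close> (meaningful on \<open>X\<^bsub>g\<^sup>-\<^sup>1\<^esub>\<close> only).\<close>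

definition action_domain ::
  "('g, 'm) monoid_scheme \<Rightarrow> 'x set \<Rightarrow> ('g \<Rightarrow> 'x \<Rightarrow> 'x option) \<Rightarrow> ('g \<times> 'x) set" where
  "action_domain G X \<eta> = {(g, x). g \<in> carrier G \<and> x \<in> X \<and> \<eta> g x \<noteq> None}"

definition action_range ::
  "('g, 'm) monoid_scheme \<Rightarrow> 'x set \<Rightarrow> ('g \<Rightarrow> 'x \<Rightarrow> 'x option) \<Rightarrow> 'g \<Rightarrow> 'x set" where
  "action_range G X \<eta> g = {x \<in> X. \<eta> (inv\<^bsub>G\<^esub> g) x \<noteq> None}"

definition action_map :: "('g \<Rightarrow> 'x \<Rightarrow> 'x option) \<Rightarrow> 'g \<Rightarrow> 'x \<Rightarrow> 'x" where
  "action_map \<eta> g x = the (\<eta> g x)"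

locale topological_partial_action =
  topological_group G TG + partial_action G "topspace TX" \<eta>
  for G (structure) and TG :: "'g topology" and TX :: "'x topology" and \<eta> +
  assumes openin_action_range:
      "g \<in> carrier G \<Longrightarrow> openin TX (action_range G (topspace TX) \<eta> g)"
    and homeomorphic_action_map:
      "g \<in> carrier G \<Longrightarrow>
         homeomorphic_map (subtopology TX (action_range G (topspace TX) \<eta> (inv g)))
           (subtopology TX (action_range G (topspace TX) \<eta> g)) (action_map \<eta> g)"

locale continuous_partial_action = topological_partial_action +
  assumes continuous_action:
      "continuous_map (subtopology (prod_topology TG TX) (action_domain G (topspace TX) \<eta>)) TX
         (\<lambda>(g, x). action_map \<eta> g x)"


section \<open>The enveloping space\<close>

definition quotient_topology :: "'a topology \<Rightarrow> 'a rel \<Rightarrow> 'a set topology" where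
  "quotient_topology X R =
     topology (\<lambda>U. U \<subseteq> topspace X // R \<and> openin X {x \<in> topspace X. R `` {x} \<in> U})"

lemma openin_quotient_topology:
  "openin (quotient_topology X R) U \<longleftrightarrow>
     U \<subseteq> topspace X // R \<and> openin X {x \<in> topspace X. R `` {x} \<in> U}"
proof -
  have "istopology (\<lambda>U. U \<subseteq> topspace X // R \<and> openin X {x \<in> topspace X. R `` {x} \<in> U})"
    unfolding istopology_def
  proof (intro conjI allI impI)
    fix S T
    assume ST: "S \<subseteq> topspace X // R \<and> openin X {x \<in> topspace X. R `` {x} \<in> S}"
      "T \<subseteq> topspace X // R \<and> openin X {x \<in> topspace X. R `` {x} \<in> T}"
    have "{x \<in> topspace X. R `` {x} \<in> S \<inter> T} =
        {x \<in> topspace X. R `` {x} \<in> S} \<inter> {x \<in> topspace X. R `` {x} \<in> T}" by auto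
    then show "openin X {x \<in> topspace X. R `` {x} \<in> S \<inter> T}" using ST by (simp add: openin_Int)
    show "S \<inter> T \<subseteq> topspace X // R" using ST by auto
  next
    fix \<K>
    assume K: "\<forall>K\<in>\<K>. K \<subseteq> topspace X // R \<and> openin X {x \<in> topspace X. R `` {x} \<in> K}"
    have "{x \<in> topspace X. R `` {x} \<in> \<Union>\<K>} = (\<Union>K\<in>\<K>. {x \<in> topspace X. R `` {x} \<in> K})" by auto
    then show "openin X {x \<in> topspace X. R `` {x} \<in> \<Union>\<K>}" using K by auto
    show "\<Union>\<K> \<subseteq> topspace X // R" using K by auto
  qed
  then show ?thesis by (simp add: quotient_topology_def)
qed

lemma topspace_quotient_topology: "topspace (quotient_topology X R) = topspace X // R"
proof
  show "topspace (quotient_topology X R) \<subseteq> topspace X // R"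
    using openin_topspace[of "quotient_topology X R"] unfolding openin_quotient_topology by blast
  have "{x \<in> topspace X. R `` {x} \<in> topspace X // R} = topspace X" by (auto intro: quotientI)
  then have "openin (quotient_topology X R) (topspace X // R)"
    by (simp add: openin_quotient_topology)
  then show "topspace X // R \<subseteq> topspace (quotient_topology X R)" by (rule openin_subset)
qed

lemma quotient_map_quotient_topology:
  "quotient_map X (quotient_topology X R) (\<lambda>x. R `` {x})"
  unfolding quotient_map_def topspace_quotient_topology openin_quotient_topology
  by (auto simp: quotient_def)

definition enveloping_rel ::
  "('g, 'm) monoid_scheme \<Rightarrow> 'x set \<Rightarrow> ('g \<Rightarrow> 'x \<Rightarrow> 'x option) \<Rightarrow> ('g \<times> 'x) rel" where
  "enveloping_rel G X \<eta> =
     {((g, x), (h, y)). g \<in> carrier G \<and> x \<in> X \<and> h \<in> carrier G \<and> y \<in> X \<and>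
        x \<in> action_range G X \<eta> (inv\<^bsub>G\<^esub> g \<otimes>\<^bsub>G\<^esub> h) \<and>
        action_map \<eta> (inv\<^bsub>G\<^esub> h \<otimes>\<^bsub>G\<^esub> g) x = y}"

lemma (in partial_action) enveloping_rel_iff:
  assumes "g \<in> carrier G" "h \<in> carrier G" "x \<in> X"
  shows "((g, x), (h, y)) \<in> enveloping_rel G X \<eta> \<longleftrightarrow> \<eta> (inv h \<otimes> g) x = Some y"
  using assms action_closed[of "inv h \<otimes> g" x y]
  by (auto simp: enveloping_rel_def action_range_def action_map_def inv_mult_group)

lemma (in partial_action) equiv_enveloping_rel: "equiv (carrier G \<times> X) (enveloping_rel G X \<eta>)"
proof (rule equivI)
  show sub: "enveloping_rel G X \<eta> \<subseteq> (carrier G \<times> X) \<times> (carrier G \<times> X)"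
    by (auto simp: enveloping_rel_def)
  show "refl_on (carrier G \<times> X) (enveloping_rel G X \<eta>)"
    by (auto simp: refl_on_def enveloping_rel_iff PA3)
  show "sym (enveloping_rel G X \<eta>)"
  proof (rule symI, clarify)
    fix g x h y assume gh: "((g, x), (h, y)) \<in> enveloping_rel G X \<eta>"
    then have m: "g \<in> carrier G" "h \<in> carrier G" "x \<in> X" "y \<in> X" using sub by auto
    then show "((h, y), (g, x)) \<in> enveloping_rel G X \<eta>"
      using gh PA1[of "inv h \<otimes> g" x y] by (simp add: enveloping_rel_iff inv_mult_group)
  qed
  show "trans (enveloping_rel G X \<eta>)"
  proof (rule transI, clarify)
    fix g x h y k z
    assume 1: "((g, x), (h, y)) \<in> enveloping_rel G X \<eta>"
      and 2: "((h, y), (k, z)) \<in> enveloping_rel G X \<eta>"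
    then have m: "g \<in> carrier G" "h \<in> carrier G" "k \<in> carrier G" "x \<in> X" "y \<in> X" using sub by auto
    have "(inv k \<otimes> h) \<otimes> (inv h \<otimes> g) = inv k \<otimes> g"
      using m by (metis inv_closed m_assoc m_closed r_inv l_one)
    then show "((g, x), (k, z)) \<in> enveloping_rel G X \<eta>"
      using 1 2 m PA2[of "inv k \<otimes> h" "inv h \<otimes> g" x y z] by (simp add: enveloping_rel_iff)
  qed
qed

definition enveloping_space ::
  "('g, 'm) monoid_scheme \<Rightarrow> 'g topology \<Rightarrow> 'x topology \<Rightarrow> ('g \<Rightarrow> 'x \<Rightarrow> 'x option)
     \<Rightarrow> ('g \<times> 'x) set topology" where
  "enveloping_space G TG TX \<eta> =
     quotient_topology (prod_topology TG TX) (enveloping_rel G (topspace TX) \<eta>)"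

end

theory Submission
  imports Defs
begin

text \<open>
  The quotient map \<open>q\<close> from \<open>G \<times> X\<close> onto the enveloping space is open, because every point
  \<open>(h, y)\<close> equivalent to \<open>(g, x)\<close> is carried to \<open>(g, x)\<close> by a homeomorphism between open sets, namely
  \<open>(h', y') \<mapsto> (h' k\<^sup>-\<^sup>1, k \<cdot> y')\<close> with \<open>k = g\<^sup>-\<^sup>1 h\<close>, that moves every point within its
  class (\<open>openin_enveloping_rel_Image\<close>).  The hypothesis that \<open>G * X\<close> is closed makes the enveloping
  relation a closed subset of the square of \<open>G \<times> X\<close>, since it is the preimage of the graph of the
  continuous map \<open>G * X \<rightarrow> X\<close> (\<open>closedin_enveloping_rel\<close>).  An open quotient by a closed
  relation is Hausdorff.

  Finally, \<open>G \<times> X\<close> is profinite, and profiniteness passes to Hausdorff images under continuous open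
  maps: the image of a clopen set is open, and it is compact, hence closed, so the images of clopen
  neighbourhoods are clopen neighbourhoods (\<open>profinite_space_open_continuous_image\<close>).
\<close>

section \<open>Products and open quotients of profinite spaces\<close>

lemma dim_le_0_clopen_neighbourhood_iff:
  "X dim_le 0 \<longleftrightarrow>
     (\<forall>W x. openin X W \<and> x \<in> W \<longrightarrow> (\<exists>U. closedin X U \<and> openin X U \<and> x \<in> U \<and> U \<subseteq> W))"
  unfolding dimension_le_0_neighbourhood_base_of_clopen
  by (subst open_neighbourhood_base_of) auto

lemma profinite_space_clopen_neighbourhood:
  assumes "profinite_space X" "openin X W" "x \<in> W"
  obtains U where "closedin X U" "openin X U" "x \<in> U" "U \<subseteq> W"
proof -
  have "X dim_le 0" using assms(1) by (simp add: profinite_space_iff)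
  then show ?thesis
    using that assms(2,3) unfolding dim_le_0_clopen_neighbourhood_iff by meson
qed

lemma profinite_space_prod_topology:
  assumes "profinite_space X" "profinite_space Y"
  shows "profinite_space (prod_topology X Y)"
proof -
  have "prod_topology X Y dim_le 0"
    unfolding dim_le_0_clopen_neighbourhood_iff
  proof (intro allI impI, elim conjE)
    fix W z
    assume W: "openin (prod_topology X Y) W" "z \<in> W"
    then have "(fst z, snd z) \<in> W" by simp
    then obtain U V where UV: "openin X U" "openin Y V" "fst z \<in> U" "snd z \<in> V" "U \<times> V \<subseteq> W"
      using W(1) unfolding openin_prod_topology_alt by meson
    obtain U' where "closedin X U'" "openin X U'" "fst z \<in> U'" "U' \<subseteq> U"
      by (rule profinite_space_clopen_neighbourhood[OF assms(1) UV(1,3)])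
    moreover obtain V' where "closedin Y V'" "openin Y V'" "snd z \<in> V'" "V' \<subseteq> V"
      by (rule profinite_space_clopen_neighbourhood[OF assms(2) UV(2,4)])
    ultimately show "\<exists>C. closedin (prod_topology X Y) C \<and> openin (prod_topology X Y) C \<and> z \<in> C \<and> C \<subseteq> W"
      using UV(5)
      by (intro exI[of _ "U' \<times> V'"])
        (auto simp: openin_prod_Times_iff closedin_prod_Times_iff mem_Times_iff)
  qed
  then show ?thesis
    using assms
    by (simp add: profinite_space_iff compact_space_prod_topology Hausdorff_space_prod_topology)
qed

text \<open>Openness of the map is what transports zero-dimensionality: a continuous image of a profinite
  space can be connected, as for the Cantor set mapped onto an interval.\<close>

lemma profinite_space_open_continuous_image:
  assumes X: "profinite_space X" and Y: "Hausdorff_space Y"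
    and q: "continuous_map X Y q" "open_map X Y q" "q ` topspace X = topspace Y"
  shows "profinite_space Y"
proof -
  have cpt: "compact_space X" using X by (simp add: profinite_space_iff)
  have "compactin Y (q ` topspace X)"
    using cpt q(1) by (intro image_compactin[of X]) (simp_all add: compact_space_def)
  then have "compact_space Y" by (simp add: q(3) compact_space_def)
  moreover have "Y dim_le 0"
    unfolding dim_le_0_clopen_neighbourhood_iff
  proof (intro allI impI, elim conjE)
    fix W y
    assume W: "openin Y W" "y \<in> W"
    then have "y \<in> q ` topspace X" using openin_subset[OF W(1)] q(3) by auto
    then obtain x where x: "x \<in> topspace X" "y = q x" by auto
    have "openin X {x \<in> topspace X. q x \<in> W}"
      using q(1) W(1) by (rule openin_continuous_map_preimage)
    moreover have "x \<in> {x \<in> topspace X. q x \<in> W}" using x W(2) by simp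
    ultimately obtain U
      where U: "closedin X U" "openin X U" "x \<in> U" "U \<subseteq> {x \<in> topspace X. q x \<in> W}"
      by (rule profinite_space_clopen_neighbourhood[OF X])
    have "openin Y (q ` U)" using q(2) U(2) by (simp add: open_map_def)
    moreover have "closedin Y (q ` U)"
      by (rule compactin_imp_closedin[OF Y image_compactin[OF closedin_compact_space[OF cpt U(1)] q(1)]])
    ultimately show "\<exists>C. closedin Y C \<and> openin Y C \<and> y \<in> C \<and> C \<subseteq> W"
      using U x(2) by (intro exI[of _ "q ` U"]) auto
  qed
  ultimately show ?thesis using Y by (simp add: profinite_space_iff)
qed

lemma open_map_quotient_topology:
  assumes equiv: "equiv (topspace X) R"
    and saturation: "\<And>U. openin X U \<Longrightarrow> openin X (R `` U)"
  shows "open_map X (quotient_topology X R) (\<lambda>x. R `` {x})"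
  unfolding open_map_def openin_quotient_topology
proof (intro allI impI conjI)
  fix U assume U: "openin X U"
  show "(\<lambda>x. R `` {x}) ` U \<subseteq> topspace X // R"
    using openin_subset[OF U] by (auto intro!: quotientI)
  have "{x \<in> topspace X. R `` {x} \<in> (\<lambda>x. R `` {x}) ` U} = R `` U"
  proof (intro equalityI subsetI)
    fix x assume "x \<in> {x \<in> topspace X. R `` {x} \<in> (\<lambda>x. R `` {x}) ` U}"
    then obtain u where "u \<in> U" "x \<in> topspace X" "R `` {x} = R `` {u}" by auto
    then show "x \<in> R `` U" using equiv_class_self[OF equiv] by blast
  next
    fix x assume "x \<in> R `` U"
    then obtain u where u: "u \<in> U" "(u, x) \<in> R" by blast
    then show "x \<in> {x \<in> topspace X. R `` {x} \<in> (\<lambda>x. R `` {x}) ` U}"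
      using equiv_class_eq[OF equiv u(2)] equivE[OF equiv] by auto
  qed
  then show "openin X {x \<in> topspace X. R `` {x} \<in> (\<lambda>x. R `` {x}) ` U}"
    using saturation[OF U] by simp
qed

text \<open>A point of \<open>X \<times> X\<close> outside the closed relation has an open box around it that misses the
  relation; the sides of the box have disjoint images, which are open because the map is.\<close>

lemma Hausdorff_space_open_quotient:
  assumes equiv: "equiv (topspace X) R"
    and saturation: "\<And>U. openin X U \<Longrightarrow> openin X (R `` U)"
    and closed: "closedin (prod_topology X X) R"
  shows "Hausdorff_space (quotient_topology X R)"
  unfolding Hausdorff_space_def
proof (intro allI impI, elim conjE)
  fix a b
  assume "a \<in> topspace (quotient_topology X R)" "b \<in> topspace (quotient_topology X R)" "a \<noteq> b"
  then obtain x y where xy: "x \<in> topspace X" "y \<in> topspace X" "a = R `` {x}" "b = R `` {y}"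
    by (auto simp: topspace_quotient_topology elim!: quotientE)
  have "openin (prod_topology X X) (topspace X \<times> topspace X - R)"
    using closed by (simp add: closedin_def)
  moreover have "(x, y) \<in> topspace X \<times> topspace X - R"
    using xy \<open>a \<noteq> b\<close> equiv_class_eq[OF equiv] by blast
  ultimately obtain U V where UV: "openin X U" "openin X V" "x \<in> U" "y \<in> V"
      "U \<times> V \<subseteq> topspace X \<times> topspace X - R"
    unfolding openin_prod_topology_alt by meson
  have "(\<lambda>x. R `` {x}) ` U \<inter> (\<lambda>x. R `` {x}) ` V = {}"
  proof (rule ccontr)
    assume "(\<lambda>x. R `` {x}) ` U \<inter> (\<lambda>x. R `` {x}) ` V \<noteq> {}"
    then obtain u v where uv: "u \<in> U" "v \<in> V" "R `` {u} = R `` {v}" by auto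
    then have "v \<in> topspace X" using openin_subset[OF UV(2)] by auto
    then have "(u, v) \<in> R" using equiv_class_self[OF equiv] uv(3) by blast
    then show False using UV(5) uv by blast
  qed
  moreover have "openin (quotient_topology X R) ((\<lambda>x. R `` {x}) ` U)"
      "openin (quotient_topology X R) ((\<lambda>x. R `` {x}) ` V)"
    using open_map_quotient_topology[OF equiv saturation] UV(1,2) by (simp_all add: open_map_def)
  ultimately show "\<exists>U V. openin (quotient_topology X R) U \<and> openin (quotient_topology X R) V \<and>
      a \<in> U \<and> b \<in> V \<and> disjnt U V"
    using UV(3,4) xy(3,4) unfolding disjnt_def by blast
qed

lemma profinite_space_open_quotient:
  assumes "profinite_space X" "equiv (topspace X) R" "closedin (prod_topology X X) R"
    and "\<And>U. openin X U \<Longrightarrow> openin X (R `` U)"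
  shows "profinite_space (quotient_topology X R)"
  using assms quotient_map_quotient_topology[of X R]
  by (intro profinite_space_open_continuous_image[of X _ "\<lambda>x. R `` {x}"]
      Hausdorff_space_open_quotient open_map_quotient_topology)
    (auto simp: quotient_imp_continuous_map quotient_imp_surjective_map)

section \<open>The enveloping relation\<close>

text \<open>A point \<open>(h, y)\<close> lies in the saturation of \<open>U\<close> iff \<open>(g, g\<^sup>-\<^sup>1 h \<cdot> y) \<in> U\<close> for some
  \<open>g\<close>.  When \<open>(h, y)\<close> varies, it is \<open>k = g\<^sup>-\<^sup>1 h\<close> that has to stay fixed: then only the openness of
  the domain of \<open>\<eta>\<^sub>k\<close> and the continuity of \<open>\<eta>\<^sub>k\<close> enter.  With \<open>g\<close> fixed, the point
  \<open>(g\<^sup>-\<^sup>1 h, y)\<close> would move within \<open>G * X\<close>, which need not be open.\<close>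

lemma (in topological_partial_action) openin_enveloping_rel_Image:
  assumes U: "openin (prod_topology TG TX) U"
  shows "openin (prod_topology TG TX) (enveloping_rel G (topspace TX) \<eta> `` U)"
proof -
  let ?X = "topspace TX"
  define D where "D k = action_range G ?X \<eta> (inv k)" for k
  define T where "T k = (\<lambda>(h, y). (h \<otimes> inv k, action_map \<eta> k y))" for k
  define S where "S k = {p \<in> carrier G \<times> D k. T k p \<in> U}" for k
  have U_sub: "U \<subseteq> carrier G \<times> ?X"
    using openin_subset[OF U] by (simp add: topspace_eq_carrier)
  have D_sub: "D k \<subseteq> ?X" for k by (auto simp: D_def action_range_def)
  have "openin (prod_topology TG TX) (S k)" if k: "k \<in> carrier G" for k
  proof -
    let ?P = "prod_topology TG (subtopology TX (D k))"
    have "continuous_map (subtopology TX (D k)) TX (action_map \<eta> k)"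
      using homeomorphic_imp_continuous_map[OF homeomorphic_action_map[OF k]]
      by (simp add: D_def continuous_map_in_subtopology)
    then have "continuous_map ?P TX (action_map \<eta> k \<circ> snd)"
      using continuous_map_compose continuous_map_snd by blast
    moreover have "continuous_map TG TG ((\<lambda>(g, h). g \<otimes> h) \<circ> (\<lambda>h. (h, inv k)))"
      using k topspace_eq_carrier
      by (intro continuous_map_compose[OF _ continuous_mult]) (auto intro!: continuous_map_pairedI)
    then have "continuous_map ?P TG (((\<lambda>(g, h). g \<otimes> h) \<circ> (\<lambda>h. (h, inv k))) \<circ> fst)"
      using continuous_map_compose continuous_map_fst by blast
    ultimately have "continuous_map ?P (prod_topology TG TX) (T k)"
      by (auto simp: T_def o_def case_prod_unfold intro!: continuous_map_pairedI)
    then have "openin ?P {p \<in> topspace ?P. T k p \<in> U}"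
      using U by (rule openin_continuous_map_preimage)
    moreover have "topspace ?P = carrier G \<times> D k"
      using D_sub[of k] by (auto simp: topspace_eq_carrier)
    ultimately have "openin ?P (S k)" by (simp add: S_def)
    moreover have "?P = subtopology (prod_topology TG TX) (topspace TG \<times> D k)"
      by (simp add: prod_topology_subtopology(2))
    moreover have "openin (prod_topology TG TX) (topspace TG \<times> D k)"
      using openin_action_range[of "inv k"] k by (simp add: openin_prod_Times_iff D_def)
    ultimately show ?thesis by (metis openin_trans_full)
  qed
  moreover have "enveloping_rel G ?X \<eta> `` U = (\<Union>k\<in>carrier G. S k)"
  proof (intro equalityI subsetI)
    fix p assume "p \<in> enveloping_rel G ?X \<eta> `` U"
    then obtain u where "(u, p) \<in> enveloping_rel G ?X \<eta>" "u \<in> U" by (rule ImageE)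
    moreover obtain g x where "u = (g, x)" by (rule prod.exhaust)
    moreover obtain h y where p: "p = (h, y)" by (rule prod.exhaust)
    ultimately have gx: "(g, x) \<in> U" and R: "((g, x), (h, y)) \<in> enveloping_rel G ?X \<eta>"
      by simp_all
    then have m: "g \<in> carrier G" "h \<in> carrier G" "x \<in> ?X" "y \<in> ?X"
      by (auto simp: enveloping_rel_def)
    then have "\<eta> (inv h \<otimes> g) x = Some y" using R enveloping_rel_iff by blast
    then have y: "\<eta> (inv g \<otimes> h) y = Some x"
      using m PA1[of "inv h \<otimes> g" x y] by (simp add: inv_mult_group)
    have "h \<otimes> inv (inv g \<otimes> h) = g"
      using m by (simp add: inv_mult_group m_assoc[symmetric])
    then have "(h, y) \<in> S (inv g \<otimes> h)"
      using m gx y by (simp add: S_def D_def T_def action_range_def action_map_def)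
    then show "p \<in> (\<Union>k\<in>carrier G. S k)"
      using m p by (intro UN_I[of "inv g \<otimes> h"]) simp_all
  next
    fix p assume "p \<in> (\<Union>k\<in>carrier G. S k)"
    then obtain k where k: "k \<in> carrier G" and "p \<in> S k" by (rule UN_E)
    moreover obtain h y where p: "p = (h, y)" by (rule prod.exhaust)
    ultimately have S: "(h, y) \<in> S k" by simp
    then have m: "h \<in> carrier G" "y \<in> ?X" "(h \<otimes> inv k, action_map \<eta> k y) \<in> U"
      using D_sub by (auto simp: S_def T_def)
    have k_y: "\<eta> k y = Some (action_map \<eta> k y)"
      using S k by (auto simp: S_def D_def action_range_def action_map_def)
    have "inv h \<otimes> (h \<otimes> inv k) = inv k"
      using m k by (simp add: m_assoc[symmetric])
    then have "((h \<otimes> inv k, action_map \<eta> k y), (h, y)) \<in> enveloping_rel G ?X \<eta>"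
      using m k U_sub PA1[OF k m(2) k_y] by (subst enveloping_rel_iff) auto
    then show "p \<in> enveloping_rel G ?X \<eta> `` U"
      unfolding p using m(3) by (rule ImageI)
  qed
  ultimately show ?thesis by auto
qed

text \<open>Two points \<open>(g, x)\<close> and \<open>(h, y)\<close> are equivalent iff \<open>\<phi>\<close> below maps the pair into \<open>G * X\<close> and the
  action sends its value to \<open>y\<close>.  The first condition is closed because \<open>G * X\<close> is; on the
  closed set \<open>C\<close> that it cuts out, the second equates two continuous maps into a Hausdorff space.\<close>

lemma (in continuous_partial_action) closedin_enveloping_rel:
  assumes X: "Hausdorff_space TX"
    and closed: "closedin (prod_topology TG TX) (action_domain G (topspace TX) \<eta>)"
  shows "closedin (prod_topology (prod_topology TG TX) (prod_topology TG TX))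
           (enveloping_rel G (topspace TX) \<eta>)"
proof -
  let ?P = "prod_topology (prod_topology TG TX) (prod_topology TG TX)"
  let ?A = "action_domain G (topspace TX) \<eta>"
  define \<phi> :: "('a \<times> 'c) \<times> ('a \<times> 'c) \<Rightarrow> 'a \<times> 'c" where "\<phi> =
      (\<lambda>((g, x), (h, y)). (inv h \<otimes> g, x))"
  define C where "C = {p \<in> topspace ?P. \<phi> p \<in> ?A}"
  have "continuous_map ?P TG ((\<lambda>g. inv g) \<circ> (fst \<circ> snd))"
    by (rule continuous_map_compose[OF _ continuous_inv])
      (rule continuous_map_compose[OF continuous_map_snd continuous_map_fst])
  moreover have "continuous_map ?P TG (fst \<circ> fst)" "continuous_map ?P TX (snd \<circ> fst)"
    by (rule continuous_map_compose[OF continuous_map_fst continuous_map_fst])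
      (rule continuous_map_compose[OF continuous_map_fst continuous_map_snd])
  ultimately have "continuous_map ?P (prod_topology TG TX)
      (\<lambda>p. (((\<lambda>(g, h). g \<otimes> h) \<circ> (\<lambda>p. (inv (fst (snd p)), fst (fst p)))) p, snd (fst p)))"
    by (intro continuous_map_pairedI continuous_map_compose[OF _ continuous_mult])
      (simp_all add: o_def)
  then have \<phi>: "continuous_map ?P (prod_topology TG TX) \<phi>"
    by (simp add: \<phi>_def o_def case_prod_unfold)
  have C: "closedin ?P C"
    unfolding C_def using \<phi> closed by (rule closedin_continuous_map_preimage)
  have "continuous_map (subtopology ?P C) (subtopology (prod_topology TG TX) ?A) \<phi>"
    using \<phi> by (auto simp: continuous_map_in_subtopology C_def intro: continuous_map_from_subtopology)
  then have "continuous_map (subtopology ?P C) TX ((\<lambda>(g, x). action_map \<eta> g x) \<circ> \<phi>)"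
    using continuous_action by (rule continuous_map_compose)
  moreover have "continuous_map (subtopology ?P C) TX (snd \<circ> snd)"
    by (intro continuous_map_from_subtopology continuous_map_compose[OF continuous_map_snd continuous_map_snd])
  ultimately have "closedin (subtopology ?P C) {p \<in> topspace (subtopology ?P C).
      ((\<lambda>(g, x). action_map \<eta> g x) \<circ> \<phi>) p = (snd \<circ> snd) p}"
    by (rule closedin_continuous_maps_eq[OF X])
  moreover have "{p \<in> topspace (subtopology ?P C).
      ((\<lambda>(g, x). action_map \<eta> g x) \<circ> \<phi>) p = (snd \<circ> snd) p} = enveloping_rel G (topspace TX) \<eta>"
    by (auto simp: C_def \<phi>_def action_domain_def enveloping_rel_def action_range_def
        topspace_eq_carrier inv_mult_group)
  ultimately show ?thesis using C by (metis closedin_trans_full)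
qed

theorem corollary3p3:
  fixes G :: "('g, 'm) monoid_scheme" and TG :: "'g topology" and TX :: "'x topology"
    and \<eta> :: "'g \<Rightarrow> 'x \<Rightarrow> 'x option"
  assumes "profinite_group G TG"
    and "profinite_space TX"
    and "continuous_partial_action G TG TX \<eta>"
    and "closedin (prod_topology TG TX) (action_domain G (topspace TX) \<eta>)"
  shows "profinite_space (enveloping_space G TG TX \<eta>)"
proof -
  interpret continuous_partial_action G TG TX \<eta> by fact
  show ?thesis
    unfolding enveloping_space_def
  proof (rule profinite_space_open_quotient)
    show "profinite_space (prod_topology TG TX)"
      using assms(1,2) by (simp add: profinite_group_def profinite_space_prod_topology)
    show "equiv (topspace (prod_topology TG TX)) (enveloping_rel G (topspace TX) \<eta>)"
      using equiv_enveloping_rel by (simp add: topspace_eq_carrier)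
  qed (use assms in \<open>auto intro: closedin_enveloping_rel openin_enveloping_rel_Image
      simp: profinite_space_iff\<close>)
qed

end
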